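(* In the standing setting of the context, assume that $\mathcal{M}=\mathcal{S}(\bar\Theta)$ is convex and that: (a) for every $w\in(0,\infty)$ the restriction of $\phi$ to $[0,1/w]$ is strongly convex; (b) $\mathcal{S}(\mathring\Theta)=\mathcal{M}\cap(0,1)^m$; (c) for any $t\in(0,1)^m$, all $\phi$-projections of $t$ on $\mathcal{M}$ belong to $(0,1)^m$; (d) $\bar\Theta$ is convex and there exist an $m\times k$ matrix $A$ and $\gamma\in\mathbb{R}^m$ such that $\mathcal{S}(\theta)=A\theta+\gamma$ for all $\theta\in\bar\Theta$. Then the function $\vartheta^*$ is continuously differentiable at $t_0=(t_{0,1},\dots,t_{0,m})\in(0,1)^m$ with Jacobian matrix at $t_0$ given by $$J[\vartheta^*](t_0)=\left[A^\top\mathrm{diag}\left(\frac{1}{t_{0,1}}\phi''\left(\frac{\mathcal{S}_1(\vartheta^*(t_0))}{t_{0,1}}\right),\dots,\frac{1}{t_{0,m}}\phi''\left(\frac{\mathcal{S}_m(\vartheta^*(t_0))}{t_{0,m}}\right)\right)A\right]^{-1}A^\top\Delta(t_0),$$ where $$\Delta(t_0)=\mathrm{diag}\left(\frac{\mathcal{S}_1(\vartheta^*(t_0))}{t_{0,1}^2}\phi''\left(\frac{\mathcal{S}_1(\vartheta^*(t_0))}{t_{0,1}}\right),\dots,\frac{\mathcal{S}_m(\vartheta^*(t_0))}{t_{0,m}^2}\phi''\left(\frac{\mathcal{S}_m(\vartheta^*(t_0))}{t_{0,m}}\right)\right),$$ and the function $\mathcal{S}^*$ is continuously differentiable at $t_0$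 with Jacobian matrix at $t_0$ given by $J[\mathcal{S}^*](t_0)=A\,J[\vartheta^*](t_0)$.
   Context: Fix a positive integer $m$. The function $\phi:[0,\infty)\to\mathbb{R}$ is convex and continuous at $0$. Define $f:[0,\infty)^2\to\mathbb{R}\cup\{\infty\}$ by $f(v,w)=w\,\phi(v/w)$ if $v\ge 0$, $w>0$; $f(v,0)=v\lim_{x\to\infty}\phi(x)/x$ if $v>0$ (the limit exists in $\mathbb{R}\cup\{\infty\}$); and $f(0,0)=0$. For $s,t\in[0,\infty)^m$, $D_\phi(s\mid t)=\sum_{i=1}^m f(s_i,t_i)$. A $\phi$-projection of $t$ on a nonempty set $\mathcal{M}$ is an element $s^*\in\mathcal{M}$ with $D_\phi(s^*\mid t)=\inf_{s\in\mathcal{M}}D_\phi(s\mid t)$. Standing assumptions: $\phi$ is strictly convex and twice continuously differentiable on $(0,\infty)$. For some positive integer $k\le m$, $\Theta\subset\mathbb{R}^k$ is bounded, with closure $\bar\Theta$ and nonempty interior $\mathring\Theta$; $\mathcal{S}=(\mathcal{S}_1,\dots,\mathcal{S}_m):\bar\Theta\to[0,1]^m$ is continuous, injective, twice continuously differentiable on $\mathring\Theta$, and satisfies $\mathcal{S}(\mathring\Theta)\subset(0,1)^m$; and $\mathcal{M}=\mathcal{S}(\bar\Theta)$. A point $t_0\in(0,1)^m$ is fixed. For $t$ in an open neighborhood of $t_0$ contained in $(0,1)^m$: $\mathcal{S}^*(t)=\operatorname*{arg\,inf}_{s\in\mathcal{M}}D_\phi(s\mid t)$ is the unique $\phi$-projection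 of $t$ on $\mathcal{M}$, and $\vartheta^*(t)=\operatorname*{arg\,inf}_{\theta\in\mathring\Theta}D_\phi(\mathcal{S}(\theta)\mid t)$ is the unique $\theta\in\mathring\Theta$ with $\mathcal{S}(\theta)=\mathcal{S}^*(t)$ (that these are well defined is part of the assertion). A function $H$ from a convex set $\mathcal{Y}\subset\mathbb{R}^d$ to $\mathbb{R}$ is strongly convex if there is a constant $\kappa_H\in(0,\infty)$ such that for all $x,y\in\mathcal{Y}$ and $\alpha\in[0,1]$, $H(\alpha x+(1-\alpha)y)\le \alpha H(x)+(1-\alpha)H(y)-\frac{\kappa_H}{2}\alpha(1-\alpha)\|x-y\|_2^2$. $J[g](y)$ denotes the usual Jacobian matrix of $g$ at $y$. "Continuously differentiable at $t_0$" means differentiable on an open neighborhood of $t_0$ with Jacobian continuous at $t_0$. *)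

theory Defs
  imports "HOL-Analysis.Analysis"
begin

definition strictly_convex_on :: "'a::real_vector set \<Rightarrow> ('a \<Rightarrow> real) \<Rightarrow> bool" where
  "strictly_convex_on Y H \<longleftrightarrow> convex Y \<and>
     (\<forall>x\<in>Y. \<forall>y\<in>Y. \<forall>\<alpha>. x \<noteq> y \<longrightarrow> 0 < \<alpha> \<longrightarrow> \<alpha> < 1 \<longrightarrow>
        H (\<alpha> *\<^sub>R x + (1 - \<alpha>) *\<^sub>R y) < \<alpha> * H x + (1 - \<alpha>) * H y)"

definition strongly_convex_on :: "'a::euclidean_space set \<Rightarrow> ('a \<Rightarrow> real) \<Rightarrow> bool" where
  "strongly_convex_on Y H \<longleftrightarrow> convex Y \<and>
     (\<exists>\<kappa>>0. \<forall>x\<in>Y. \<forall>y\<in>Y. \<forall>\<alpha>\<in>{0..1}.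
        H (\<alpha> *\<^sub>R x + (1 - \<alpha>) *\<^sub>R y)
          \<le> \<alpha> * H x + (1 - \<alpha>) * H y - \<kappa> / 2 * \<alpha> * (1 - \<alpha>) * (norm (x - y))\<^sup>2)"

text \<open>The next two notions are used for open sets \<open>U\<close> only.\<close>

definition real_C2_on :: "real set \<Rightarrow> (real \<Rightarrow> real) \<Rightarrow> bool" where
  "real_C2_on U g \<longleftrightarrow>
     (\<forall>x\<in>U. g differentiable at x) \<and> (\<forall>x\<in>U. deriv g differentiable at x) \<and>
     continuous_on U (deriv (deriv g))"

definition C2_on :: "'a::euclidean_space set \<Rightarrow> ('a \<Rightarrow> 'b::euclidean_space) \<Rightarrow> bool" where
  "C2_on U g \<longleftrightarrow>
     (\<exists>(g' :: 'a \<Rightarrow> 'a \<Rightarrow>\<^sub>L 'b) (g'' :: 'a \<Rightarrow> 'a \<Rightarrow>\<^sub>L 'a \<Rightarrow>\<^sub>L 'b).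
        (\<forall>x\<in>U. (g has_derivative blinfun_apply (g' x)) (at x)) \<and>
        (\<forall>x\<in>U. (g' has_derivative blinfun_apply (g'' x)) (at x)) \<and>
        continuous_on U g'')"

definition continuously_differentiable_at :: "(real^'m \<Rightarrow> real^'n) \<Rightarrow> real^'m \<Rightarrow> bool" where
  "continuously_differentiable_at g x \<longleftrightarrow>
     (\<exists>U. open U \<and> x \<in> U \<and> (\<forall>y\<in>U. g differentiable at y)) \<and>
     isCont (\<lambda>y. jacobian g (at y)) x"

definition diag_matrix :: "real^'n \<Rightarrow> real^'n^'n" where
  "diag_matrix v = (\<chi> i j. if i = j then v $ i else 0)"

text \<open>
  The integrand and the divergence are meant for nonnegative arguments only. The limit is taken
  in the extended reals; for convex \<open>\<phi>\<close> it exists and differs from \<open>-\<infinity>\<close>.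
\<close>

definition phi_integrand :: "(real \<Rightarrow> real) \<Rightarrow> real \<Rightarrow> real \<Rightarrow> ereal" where
  "phi_integrand \<phi> v w =
     (if w > 0 then ereal (w * \<phi> (v / w))
      else if v > 0 then ereal v * Lim at_top (\<lambda>x. ereal (\<phi> x / x))
      else 0)"

definition phi_div :: "(real \<Rightarrow> real) \<Rightarrow> real^'m \<Rightarrow> real^'m \<Rightarrow> ereal" where
  "phi_div \<phi> s t = (\<Sum>i\<in>UNIV. phi_integrand \<phi> (s $ i) (t $ i))"

definition is_arg_inf :: "('a \<Rightarrow> ereal) \<Rightarrow> 'a set \<Rightarrow> 'a \<Rightarrow> bool" where
  "is_arg_inf F X x \<longleftrightarrow> x \<in> X \<and> F x = (INF y\<in>X. F y)"

text \<open>Meaningful only when there is exactly one point of \<open>X\<close> at which the infimum is attained.\<close>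

definition arg_inf :: "('a \<Rightarrow> ereal) \<Rightarrow> 'a set \<Rightarrow> 'a" where
  "arg_inf F X = (THE x. is_arg_inf F X x)"

definition is_phi_projection :: "(real \<Rightarrow> real) \<Rightarrow> (real^'m) set \<Rightarrow> real^'m \<Rightarrow> real^'m \<Rightarrow> bool" where
  "is_phi_projection \<phi> M t s \<longleftrightarrow> is_arg_inf (\<lambda>s. phi_div \<phi> s t) M s"

definition S_star :: "(real \<Rightarrow> real) \<Rightarrow> (real^'m) set \<Rightarrow> real^'m \<Rightarrow> real^'m" where
  "S_star \<phi> M t = arg_inf (\<lambda>s. phi_div \<phi> s t) M"

definition theta_star ::
  "(real \<Rightarrow> real) \<Rightarrow> (real^'k) set \<Rightarrow> (real^'k \<Rightarrow> real^'m) \<Rightarrow> real^'m \<Rightarrow> real^'k" where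
  "theta_star \<phi> \<Theta> S t = arg_inf (\<lambda>\<theta>. phi_div \<phi> (S \<theta>) t) (interior \<Theta>)"

end

theory Submission
  imports Defs
begin

text \<open>
  For \<open>t\<close> in the open unit cube, \<open>D\<close> restricted to \<open>M\<close> is a real-valued, continuous, strictly
  convex function on a compact convex set, so the projection exists, is unique, and depends
  continuously on \<open>t\<close>, because its graph is closed and \<open>M\<close> is compact. The parameter of the
  projection is an interior minimizer of \<open>\<theta> \<mapsto> D (A \<theta> + \<gamma> | t)\<close>, hence a zero of
  \<open>G (\<theta>, t) = \<Sum>\<^sub>i \<phi>' ((A \<theta> + \<gamma>)\<^sub>i / t\<^sub>i) A\<^sub>i\<close>, where \<open>A\<^sub>i\<close> is the \<open>i\<close>-th row of \<open>A\<close>. Its derivative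
  in \<open>\<theta>\<close> is positive definite: \<open>\<phi>'' > 0\<close> by strong convexity and \<open>A\<close> is injective. Since the
  continuity of the zero is already known, Frechet differentiability of \<open>G\<close> at the point alone
  gives the derivative of \<open>\<vartheta>\<^sup>*\<close>; no implicit function theorem is needed. The resulting
  formula for the Jacobian holds on the whole open cube and is continuous there.
\<close>

section \<open>Implicit differentiation and continuity of minimizers\<close>

text \<open>Applying the left inverse \<open>R\<close> reduces to the case where the derivative of
  \<open>G\<close> in its first variable is the identity. With u and v the increments of
  \<open>g\<close> and of its argument, the equation becomes u + L v = o(|u| + |v|), where
  continuity of \<open>g\<close> guarantees that u is small too. Since \<open>L\<close> is bounded,
  |u| is at most a constant times |v|, so the remainder is o(|v|).\<close>

lemma has_derivative_implicit:
  fixes g :: "'a::real_normed_vector \<Rightarrow> 'b::real_normed_vector"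
    and G :: "'b \<times> 'a \<Rightarrow> 'c::real_normed_vector"
  assumes g: "isCont g x"
    and zero: "\<forall>\<^sub>F y in nhds x. G (g y, y) = 0"
    and G: "(G has_derivative (\<lambda>(h, k). P h + Q k)) (at (g x, x))"
    and R: "bounded_linear R" "\<And>h. R (P h) = h"
  shows "(g has_derivative (\<lambda>k. - R (Q k))) (at x)"
proof -
  define L where "L = (\<lambda>k. R (Q k))"
  interpret R: bounded_linear R by fact
  have G': "((\<lambda>z. R (G z)) has_derivative (\<lambda>z. fst z + L (snd z))) (at (g x, x))"
  proof -
    have "(\<lambda>z. R (case z of (h, k) \<Rightarrow> P h + Q k)) = (\<lambda>z. fst z + L (snd z))"
      by (auto simp: fun_eq_iff R.add R(2) L_def)
    then show ?thesis
      using R.has_derivative[OF G] by simp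
  qed
  \<comment> \<open>Nothing is assumed about \<open>Q\<close> itself: boundedness and linearity of
    \<open>L\<close> are read off from the derivative of \<open>R\<close> after \<open>G\<close>,
    restricted to pairs with first entry 0.\<close>
  have "bounded_linear (\<lambda>z. fst z + L (snd z))"
    using G' by (rule has_derivative_bounded_linear)
  from bounded_linear_compose[OF this bounded_linear_Pair[OF bounded_linear_zero bounded_linear_ident]]
  have L: "bounded_linear L" by simp
  interpret L: bounded_linear L by fact
  have "R (G (g x, x)) = 0"
    using eventually_nhds_x_imp_x[OF zero] by (simp add: R.zero)
  obtain K where K: "K > 0" "\<And>k. norm (L k) \<le> norm k * K"
    using L.pos_bounded by blast
  have main: "\<exists>d>0. \<forall>y. norm (y - x) < d \<longrightarrow> norm (g y - g x + L (y - x)) \<le> e * norm (y - x)"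
    if e: "e > 0" for e
  proof -
    \<comment> \<open>The bound 1/2 allows |u| to be absorbed on the left, which gives |u| + |v|
      \<le> (2K + 2) |v|; the other bound then turns the error into at most e |v|.\<close>
    define \<epsilon> where "\<epsilon> = min (1 / 2) (e / (2 * K + 2))"
    have \<epsilon>: "\<epsilon> > 0" "\<epsilon> \<le> 1 / 2" "\<epsilon> \<le> e / (2 * K + 2)"
      using e K(1) by (simp_all only: \<epsilon>_def min.cobounded1 min.cobounded2) simp
    then have \<epsilon>': "\<epsilon> * (2 * K + 2) \<le> e"
      using K(1) by (simp add: pos_le_divide_eq)
    obtain d where d: "d > 0" "\<And>z. norm (z - (g x, x)) < d \<Longrightarrow>
        norm (R (G z) - R (G (g x, x)) - (fst (z - (g x, x)) + L (snd (z - (g x, x)))))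
          \<le> \<epsilon> * norm (z - (g x, x))"
      using G' \<epsilon>(1) unfolding has_derivative_at_alt by blast
    have "((\<lambda>y. (g y, y)) \<longlongrightarrow> (g x, x)) (nhds x)"
      using g by (intro tendsto_Pair) (auto simp: isCont_def tendsto_at_iff_tendsto_nhds filterlim_ident)
    then have "\<forall>\<^sub>F y in nhds x. dist (g y, y) (g x, x) < d"
      using d(1) by (rule tendstoD)
    then have "\<forall>\<^sub>F y in nhds x. G (g y, y) = 0 \<and> dist (g y, y) (g x, x) < d"
      using zero by (simp add: eventually_conj_iff)
    then obtain r where r: "r > 0"
        "\<And>y. dist y x < r \<Longrightarrow> G (g y, y) = 0 \<and> dist (g y, y) (g x, x) < d"
      unfolding eventually_nhds_metric by blast
    have "norm (g y - g x + L (y - x)) \<le> e * norm (y - x)" if y: "norm (y - x) < r" for y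
    proof -
      define u v where "u = g y - g x" and "v = y - x"
      have "dist (g y, y) (g x, x) < d" and G0: "R (G (g y, y)) = 0"
        using r(2)[of y] y by (simp_all add: dist_norm R.zero)
      then have "norm (R (G (g y, y)) - R (G (g x, x)) - (u + L v)) \<le> \<epsilon> * norm (u, v)"
        using d(2)[of "(g y, y)"] by (simp add: dist_norm u_def v_def)
      then have "norm (u + L v) \<le> \<epsilon> * norm (u, v)"
        by (simp only: G0 \<open>R (G (g x, x)) = 0\<close> diff_0 norm_minus_cancel diff_self)
      also have "\<dots> \<le> \<epsilon> * (norm u + norm v)"
        using \<epsilon>(1) by (intro mult_left_mono norm_Pair_le) auto
      finally have *: "norm (u + L v) \<le> \<epsilon> * (norm u + norm v)" .
      have "norm u \<le> norm (u + L v) + norm (L v)"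
        using norm_triangle_ineq4[of "u + L v" "L v"] by simp
      also have "\<dots> \<le> 1 / 2 * (norm u + norm v) + norm v * K"
        using * K(2)[of v] mult_right_mono[OF \<epsilon>(2), of "norm u + norm v"]
        by (smt (verit) norm_ge_zero)
      finally have "norm u + norm v \<le> (2 * K + 2) * norm v"
        by (simp add: field_simps)
      then have "\<epsilon> * (norm u + norm v) \<le> \<epsilon> * (2 * K + 2) * norm v"
        using \<epsilon>(1) by simp
      also have "\<dots> \<le> e * norm v"
        using \<epsilon>' by (intro mult_right_mono) auto
      finally show ?thesis using * by (simp add: u_def v_def)
    qed
    then show ?thesis using r(1) by blast
  qed
  then have "(g has_derivative (\<lambda>k. - L k)) (at x)"
    unfolding has_derivative_at_alt using bounded_linear_minus[OF L] by simp
  then show ?thesis by (simp add: L_def)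
qed

text \<open>By uniqueness, the graph of \<open>g\<close> is the set of all (t, s) with f (s, t)
  \<le> f (s', t) for every s' in \<open>K\<close>. Each of these inequalities is closed in T
  \<times> K by joint continuity of \<open>f\<close>, and a closed graph with values in a compact
  set forces continuity.\<close>

lemma continuous_on_unique_minimizer:
  fixes f :: "'a::euclidean_space \<times> 'b::euclidean_space \<Rightarrow> real"
  assumes K: "compact K" and f: "continuous_on (K \<times> T) f"
    and g: "\<And>t. t \<in> T \<Longrightarrow> g t \<in> K"
    and min: "\<And>t s. t \<in> T \<Longrightarrow> s \<in> K \<Longrightarrow> f (g t, t) \<le> f (s, t)"
    and uniq: "\<And>t s. t \<in> T \<Longrightarrow> s \<in> K \<Longrightarrow> f (s, t) \<le> f (g t, t) \<Longrightarrow> s = g t"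
  shows "continuous_on T g"
proof -
  \<comment> \<open>Here \<open>z\<close> is (t, s), the order of the graph, opposite to the order
    of the arguments of \<open>f\<close>.\<close>
  define D where "D = (\<lambda>s' (z :: 'b \<times> 'a). f (snd z, fst z) - f (s', fst z))"
  have "(\<lambda>t. (t, g t)) ` T = T \<times> K \<inter> (\<Inter>s'\<in>K. T \<times> K \<inter> D s' -` {..0})"
  proof (intro equalityI subsetI)
    fix z assume "z \<in> (\<lambda>t. (t, g t)) ` T"
    then show "z \<in> T \<times> K \<inter> (\<Inter>s'\<in>K. T \<times> K \<inter> D s' -` {..0})"
      using g min by (auto simp: D_def)
  next
    fix z assume z: "z \<in> T \<times> K \<inter> (\<Inter>s'\<in>K. T \<times> K \<inter> D s' -` {..0})"
    obtain t s where ts: "z = (t, s)" by (cases z)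
    with z have "t \<in> T" "s \<in> K" by auto
    then have "z \<in> D (g t) -` {..0}" using z g by blast
    then have "f (s, t) \<le> f (g t, t)" by (simp add: D_def ts)
    with \<open>t \<in> T\<close> \<open>s \<in> K\<close> have "s = g t" by (rule uniq)
    with \<open>t \<in> T\<close> show "z \<in> (\<lambda>t. (t, g t)) ` T" by (simp add: ts)
  qed
  moreover have "closedin (top_of_set (T \<times> K)) (T \<times> K \<inter> D s' -` {..0})" if "s' \<in> K" for s'
    unfolding D_def using that
    by (intro continuous_closedin_preimage closed_atMost continuous_intros
          continuous_on_compose2[OF f]) auto
  \<comment> \<open>An intersection over an empty \<open>K\<close> would be the whole space; in that
    case \<open>T\<close> is empty as well, since \<open>g\<close> maps it into
    \<open>K\<close>.\<close>
  then have "closedin (top_of_set (T \<times> K)) (\<Inter>s'\<in>K. T \<times> K \<inter> D s' -` {..0})" if "K \<noteq> {}"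
    using that by blast
  moreover have "T \<times> K \<inter> (\<Inter>s'\<in>K. T \<times> K \<inter> D s' -` {..0}) = (\<Inter>s'\<in>K. T \<times> K \<inter> D s' -` {..0})"
    if "K \<noteq> {}" using that by blast
  moreover have "T = {}" if "K = {}" using g that by auto
  ultimately have "closedin (top_of_set (T \<times> K)) ((\<lambda>t. (t, g t)) ` T)"
    by (cases "K = {}") (simp, simp only: not_False_eq_True)
  then show ?thesis
    using continuous_closed_graph_eq[OF K, of g T] g by auto
qed

section \<open>Strong convexity on the real line\<close>

text \<open>The square function satisfies the convexity inequality with a defect of exactly \<alpha>
  (1 - \<alpha>) (x - y)^2, so subtracting \<kappa>/2 times the square uses up precisely the gain
  from strong convexity.\<close>

lemma strongly_convex_on_imp_convex_on_diff:
  fixes f :: "real \<Rightarrow> real"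
  assumes "strongly_convex_on I f"
  obtains \<kappa> where "\<kappa> > 0" "convex_on I (\<lambda>x. f x - \<kappa> / 2 * x\<^sup>2)"
proof -
  obtain \<kappa> where "convex I" "\<kappa> > 0" and
    \<kappa>: "\<And>x y \<alpha>. x \<in> I \<Longrightarrow> y \<in> I \<Longrightarrow> \<alpha> \<in> {0..1} \<Longrightarrow> f (\<alpha> *\<^sub>R x + (1 - \<alpha>) *\<^sub>R y)
       \<le> \<alpha> * f x + (1 - \<alpha>) * f y - \<kappa> / 2 * \<alpha> * (1 - \<alpha>) * (norm (x - y))\<^sup>2"
    using assms unfolding strongly_convex_on_def by blast
  have "convex_on I (\<lambda>x. f x - \<kappa> / 2 * x\<^sup>2)"
  proof (rule convex_onI)
    fix t x y :: real
    assume "0 < t" "t < 1" "x \<in> I" "y \<in> I"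
    have *: "((1 - t) * x + t * y)\<^sup>2 = (1 - t) * x\<^sup>2 + t * y\<^sup>2 - (1 - t) * t * (x - y)\<^sup>2"
      by algebra
    from \<open>0 < t\<close> \<open>t < 1\<close> \<open>x \<in> I\<close> \<open>y \<in> I\<close> show "f ((1 - t) *\<^sub>R x + t *\<^sub>R y) - \<kappa> / 2 * ((1 - t) *\<^sub>R x + t *\<^sub>R y)\<^sup>2
        \<le> (1 - t) * (f x - \<kappa> / 2 * x\<^sup>2) + t * (f y - \<kappa> / 2 * y\<^sup>2)"
      using \<kappa>[of x y "1 - t"] by (simp add: *) (simp add: algebra_simps add_divide_distrib diff_divide_distrib)
  qed (fact \<open>convex I\<close>)
  with \<open>\<kappa> > 0\<close> show thesis by (rule that)
qed

text \<open>Removing the quadratic part leaves a convex function whose derivative is monotone on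
  \<open>J\<close>. Its difference quotients at \<open>x\<close> are therefore nonnegative, and
  their limit is d - \<kappa>; this gives the strict bound d \<ge> \<kappa> > 0.\<close>

lemma strongly_convex_on_deriv2_pos:
  fixes f :: "real \<Rightarrow> real"
  assumes f: "strongly_convex_on I f" and J: "open J" "J \<subseteq> I" "x \<in> J"
    and f': "\<And>y. y \<in> J \<Longrightarrow> (f has_field_derivative f' y) (at y)"
    and f'': "(f' has_field_derivative d) (at x)"
  shows "d > 0"
proof -
  obtain \<kappa> where \<kappa>: "\<kappa> > 0" "convex_on I (\<lambda>x. f x - \<kappa> / 2 * x\<^sup>2)"
    using f by (rule strongly_convex_on_imp_convex_on_diff)
  define \<psi> where "\<psi> y = f y - \<kappa> / 2 * y\<^sup>2" for y
  define \<psi>' where "\<psi>' y = f' y - \<kappa> * y" for y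
  have above: "\<psi>' y * (z - y) \<le> \<psi> z - \<psi> y" if "y \<in> J" "z \<in> J" for y z
  proof (rule convex_on_imp_above_tangent[of I])
    show "convex_on I \<psi>" using \<kappa>(2) by (simp add: \<psi>_def[abs_def])
    then show "connected I" by (intro convex_connected convex_on_imp_convex)
    show "y \<in> interior I" using J that by (meson interior_maximal subsetD)
    show "z \<in> I" using J that by auto
    show "(\<psi> has_field_derivative \<psi>' y) (at y within I)"
      unfolding \<psi>_def[abs_def] \<psi>'_def
      by (auto intro!: derivative_eq_intros has_field_derivative_at_within[OF f'] that)
  qed
  have "(\<psi>' has_field_derivative d - \<kappa>) (at x)"
    unfolding \<psi>'_def[abs_def] by (auto intro!: derivative_eq_intros f'')
  then have "((\<lambda>y. (\<psi>' y - \<psi>' x) / (y - x)) \<longlongrightarrow> d - \<kappa>) (at x)"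
    by (simp add: has_field_derivative_iff)
  moreover have "\<forall>\<^sub>F y in at x. 0 \<le> (\<psi>' y - \<psi>' x) / (y - x)"
  proof -
    have "\<forall>\<^sub>F y in at x. y \<in> J"
      using J by (rule_tac eventually_at_in_open') auto
    then show ?thesis
    proof eventually_elim
      case (elim y)
      \<comment> \<open>This is the sum of the tangent inequalities at \<open>x\<close> and at
        \<open>y\<close>.\<close>
      have "0 \<le> (\<psi>' y - \<psi>' x) * (y - x)"
        using above[of x y] above[of y x] elim J(3) by (simp add: algebra_simps)
      then show ?case by (simp add: zero_le_mult_iff zero_le_divide_iff)
    qed
  qed
  ultimately have "0 \<le> d - \<kappa>"
    by (rule tendsto_lowerbound) simp
  with \<kappa>(1) show ?thesis by simp
qed

lemma strongly_convex_on_imp_strictly_convex_on: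
  "strongly_convex_on Y f \<Longrightarrow> strictly_convex_on Y f"
  unfolding strongly_convex_on_def strictly_convex_on_def
proof safe
  fix \<kappa> \<alpha> :: real and x y
  assume "0 < \<kappa>" and *: "\<forall>x\<in>Y. \<forall>y\<in>Y. \<forall>\<alpha>\<in>{0..1}. f (\<alpha> *\<^sub>R x + (1 - \<alpha>) *\<^sub>R y)
       \<le> \<alpha> * f x + (1 - \<alpha>) * f y - \<kappa> / 2 * \<alpha> * (1 - \<alpha>) * (norm (x - y))\<^sup>2"
    and "x \<in> Y" "y \<in> Y" "x \<noteq> y" "0 < \<alpha>" "\<alpha> < 1"
  then have "0 < \<kappa> / 2 * \<alpha> * (1 - \<alpha>) * (norm (x - y))\<^sup>2" by simp
  with * \<open>x \<in> Y\<close> \<open>y \<in> Y\<close> \<open>0 < \<alpha>\<close> \<open>\<alpha> < 1\<close>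
  show "f (\<alpha> *\<^sub>R x + (1 - \<alpha>) *\<^sub>R y) < \<alpha> * f x + (1 - \<alpha>) * f y"
    by (smt (verit, best) atLeastAtMost_iff)
qed

section \<open>Continuity of matrix operations and weighted Gram matrices\<close>

lemma isCont_det:
  fixes F :: "'a::t2_space \<Rightarrow> real^'n^'n"
  assumes "isCont F x"
  shows "isCont (\<lambda>y. det (F y)) x"
  unfolding det_def using assms by (intro continuous_intros) auto

lemma isCont_vec_lambda:
  fixes f :: "'a::t2_space \<Rightarrow> 'n::finite \<Rightarrow> 'b::topological_space"
  assumes "\<And>i. isCont (\<lambda>x. f x i) a"
  shows "isCont (\<lambda>x. \<chi> i. f x i) a"
  using assms by (auto simp: isCont_def intro!: vec_tendstoI)

lemma matrix_inv_left_right: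
  assumes "invertible B"
  shows "matrix_inv B ** B = mat 1" "B ** matrix_inv B = mat 1"
  using someI_ex[OF assms[unfolded invertible_def]] unfolding matrix_inv_def by auto

text \<open>Column j of the inverse solves B x = e_j, so Cramer's rule gives its entries. As
  quotients of determinants they depend visibly continuously on the entries of
  \<open>B\<close>.\<close>

lemma matrix_inv_cramer:
  fixes B :: "real^'n^'n"
  assumes "invertible B"
  shows "matrix_inv B = (\<chi> k j. det (\<chi> i l. if l = k then axis j 1 $ i else B $ i $ l) / det B)"
proof -
  have "det B \<noteq> 0" using assms by (simp add: invertible_det_nz)
  have "column j (matrix_inv B) = (\<chi> k. det (\<chi> i l. if l = k then axis j 1 $ i else B $ i $ l) / det B)" for j
  proof -
    have "B *v (matrix_inv B *v axis j 1) = axis j 1"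
      using assms by (simp add: matrix_vector_mul_assoc matrix_inv_left_right)
    then show ?thesis
      using \<open>det B \<noteq> 0\<close> by (simp add: cramer matrix_vector_mult_basis)
  qed
  then show ?thesis
    by (simp add: vec_eq_iff column_def)
qed

lemma isCont_matrix_inv:
  fixes F :: "'a::t2_space \<Rightarrow> real^'n^'n"
  assumes F: "isCont F x" and inv: "\<forall>\<^sub>F y in nhds x. invertible (F y)"
  shows "isCont (\<lambda>y. matrix_inv (F y)) x"
proof -
  have "det (F x) \<noteq> 0"
    using eventually_nhds_x_imp_x[OF inv] by (simp add: invertible_det_nz)
  have "isCont (\<lambda>y. if l = k then axis j 1 $ i else F y $ i $ l) x" for i j k l
    using F by (cases "l = k") (auto intro!: isCont_vec_nth)
  then have "isCont (\<lambda>y. \<chi> k j. det (\<chi> i l. if l = k then axis j 1 $ i else F y $ i $ l) / det (F y)) x"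
    using F \<open>det (F x) \<noteq> 0\<close>
    by (intro isCont_vec_lambda isCont_divide isCont_det) auto
  moreover have "\<forall>\<^sub>F y in nhds x. matrix_inv (F y)
      = (\<chi> k j. det (\<chi> i l. if l = k then axis j 1 $ i else F y $ i $ l) / det (F y))"
    using inv by eventually_elim (rule matrix_inv_cramer)
  ultimately show ?thesis
    by (simp add: isCont_cong)
qed

lemma isCont_matrix_matrix_mult:
  fixes F :: "'a::t2_space \<Rightarrow> real^'n^'m" and H :: "'a \<Rightarrow> real^'p^'n"
  assumes "isCont F x" "isCont H x"
  shows "isCont (\<lambda>y. F y ** H y) x"
  unfolding matrix_matrix_mult_def using assms
  by (intro isCont_vec_lambda continuous_intros isCont_vec_nth) auto

lemma isCont_diag_matrix:
  fixes v :: "'a::t2_space \<Rightarrow> real^'n"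
  assumes "isCont v x"
  shows "isCont (\<lambda>y. diag_matrix (v y)) x"
  unfolding diag_matrix_def
proof (intro isCont_vec_lambda)
  show "isCont (\<lambda>y. if i = j then v y $ i else 0) x" for i j
    using assms by (cases "i = j") auto
qed

text \<open>Links the matrix products of the final formula with the sums over the rows of
  \<open>A\<close> that arise on differentiating the divergence.\<close>

lemma transpose_diag_matrix_mult_vector:
  fixes A :: "real^'k^'m"
  shows "(transpose A ** diag_matrix v) *v y = (\<Sum>i\<in>UNIV. (v $ i * y $ i) *\<^sub>R A $ i)"
  by (simp add: vec_eq_iff matrix_matrix_mult_def transpose_def diag_matrix_def
      matrix_vector_mult_def if_distrib mult_ac cong: if_cong)

text \<open>The quadratic form of this matrix at x is the sum of v_i (A x)_i^2. It vanishes only if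
  A x = 0, that is, only if x = 0, so the kernel is trivial.\<close>

lemma invertible_transpose_diag_mult:
  fixes A :: "real^'k^'m"
  assumes A: "inj ((*v) A)" and v: "\<And>i. v $ i > 0"
  shows "invertible (transpose A ** diag_matrix v ** A)"
proof -
  have "x = 0" if "(transpose A ** diag_matrix v ** A) *v x = 0" for x
  proof -
    have "0 = x \<bullet> ((transpose A ** diag_matrix v) *v (A *v x))"
      using that by (simp add: matrix_vector_mul_assoc)
    also have "\<dots> = (\<Sum>i\<in>UNIV. v $ i * ((A *v x) $ i)\<^sup>2)"
      unfolding transpose_diag_matrix_mult_vector
      by (simp add: inner_sum_right matrix_vector_mul_component power2_eq_square inner_commute mult_ac)
    finally have "\<forall>i. v $ i * ((A *v x) $ i)\<^sup>2 = 0"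
      using v by (subst (asm) eq_commute, subst (asm) sum_nonneg_eq_0_iff) (auto simp: less_imp_le)
    then have "(A *v x) $ i = 0" for i
      using v[of i] by (metis less_irrefl mult_eq_0_iff zero_eq_power2)
    then have "A *v x = A *v 0"
      by (simp add: vec_eq_iff)
    then show "x = 0" by (rule injD[OF A])
  qed
  then show ?thesis
    by (simp add: invertible_left_inverse matrix_left_invertible_ker)
qed

section \<open>Minimizers and their uniqueness\<close>

lemma is_arg_inf_iff: "is_arg_inf F X x \<longleftrightarrow> x \<in> X \<and> (\<forall>y\<in>X. F x \<le> F y)"
  unfolding is_arg_inf_def
  by (metis INF_greatest INF_lower antisym)

lemma arg_inf_eqI:
  assumes "is_arg_inf F X x" "\<And>y. is_arg_inf F X y \<Longrightarrow> y = x"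
  shows "arg_inf F X = x"
  unfolding arg_inf_def using assms by (rule the_equality)

text \<open>Otherwise the midpoint of \<open>x\<close> and \<open>y\<close>, which stays in
  \<open>X\<close>, would have a value below the minimum.\<close>

lemma strictly_convex_on_minimizer_unique:
  assumes H: "strictly_convex_on Y H" and X: "X \<subseteq> Y" "convex X"
    and x: "x \<in> X" "\<And>z. z \<in> X \<Longrightarrow> H x \<le> H z"
    and y: "y \<in> X" "H y \<le> H x"
  shows "y = x"
proof (rule ccontr)
  assume "y \<noteq> x"
  have "(1 / 2) *\<^sub>R y + (1 - 1 / 2) *\<^sub>R x \<in> X"
    using X(2) x(1) y(1) by (intro convexD) auto
  then have "H x \<le> H ((1 / 2) *\<^sub>R y + (1 - 1 / 2) *\<^sub>R x)" by (rule x(2))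
  also have "\<dots> < 1 / 2 * H y + (1 - 1 / 2) * H x"
    using H[unfolded strictly_convex_on_def, THEN conjunct2, rule_format, of y x "1 / 2"]
      X(1) x(1) y(1) \<open>y \<noteq> x\<close> by auto
  finally show False using y(2) by simp
qed

section \<open>The divergence as a real-valued function\<close>

definition real_phi_div :: "(real \<Rightarrow> real) \<Rightarrow> real^'m \<Rightarrow> real^'m \<Rightarrow> real" where
  "real_phi_div \<phi> s t = (\<Sum>i\<in>UNIV. t $ i * \<phi> (s $ i / t $ i))"

text \<open>An infinite value of the integrand can occur only when its second argument is not
  positive, so on the open cube the minimization can be carried out over the reals.\<close>

lemma phi_div_eq_real_phi_div:
  assumes "\<And>i. t $ i > 0"
  shows "phi_div \<phi> s t = ereal (real_phi_div \<phi> s t)"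
  using assms by (simp add: phi_div_def real_phi_div_def phi_integrand_def)

text \<open>Continuity is joint, because minimizers for varying \<open>t\<close> are compared.
  Coordinates of s may vanish, which is why \<phi> is taken continuous up to 0.\<close>

lemma continuous_on_real_phi_div:
  assumes \<phi>: "continuous_on {0..} \<phi>"
  shows "continuous_on ({s :: real^'m. \<forall>i. 0 \<le> s $ i} \<times> {t. \<forall>i. 0 < t $ i})
    (\<lambda>z. real_phi_div \<phi> (fst z) (snd z))"
  unfolding real_phi_div_def
proof (intro continuous_on_sum continuous_on_mult)
  fix i :: 'm
  let ?X = "{s :: real^'m. \<forall>i. 0 \<le> s $ i} \<times> {t :: real^'m. \<forall>i. 0 < t $ i}"
  show snd: "continuous_on ?X (\<lambda>z. snd z $ i)"
    by (intro continuous_intros)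
  have fst: "continuous_on ?X (\<lambda>z. fst z $ i)"
    by (intro continuous_intros)
  have pos: "0 \<le> fst z $ i" "0 < snd z $ i" if "z \<in> ?X" for z
    using that by auto
  have "continuous_on ?X (\<lambda>z. fst z $ i / snd z $ i)"
    by (rule continuous_on_divide[OF fst snd]) (rule ballI, rule less_imp_neq[THEN not_sym], rule pos(2))
  moreover have "(\<lambda>z. fst z $ i / snd z $ i) ` ?X \<subseteq> {0..}"
    by (rule image_subsetI, simp only: atLeast_iff) (rule divide_nonneg_pos, (erule pos)+)
  ultimately show "continuous_on ?X (\<lambda>z. \<phi> (fst z $ i / snd z $ i))"
    by (rule continuous_on_compose2[OF \<phi>])
qed

text \<open>The sum separates the coordinates: two distinct points differ in at least one of them,
  where the inequality is strict, and coordinates in which they agree contribute equality.\<close>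

lemma strictly_convex_on_real_phi_div:
  fixes t :: "real^'m"
  assumes \<phi>: "strictly_convex_on {0..} \<phi>" and t: "\<And>i. t $ i > 0"
  shows "strictly_convex_on {s. \<forall>i. 0 \<le> s $ i} (\<lambda>s. real_phi_div \<phi> s t)"
  unfolding strictly_convex_on_def
proof (intro conjI ballI allI impI)
  show "convex {s :: real^'m. \<forall>i. 0 \<le> s $ i}"
    by (auto simp: convex_def)
next
  fix x y :: "real^'m" and \<alpha> :: real
  assume x: "x \<in> {s. \<forall>i. 0 \<le> s $ i}" and y: "y \<in> {s. \<forall>i. 0 \<le> s $ i}"
    and "x \<noteq> y" and \<alpha>: "0 < \<alpha>" "\<alpha> < 1"
  define z where "z = \<alpha> *\<^sub>R x + (1 - \<alpha>) *\<^sub>R y"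
  have z: "z $ i / t $ i = \<alpha> *\<^sub>R (x $ i / t $ i) + (1 - \<alpha>) *\<^sub>R (y $ i / t $ i)" for i
    by (simp add: z_def add_divide_distrib)
  have less: "t $ i * \<phi> (z $ i / t $ i)
      < \<alpha> * (t $ i * \<phi> (x $ i / t $ i)) + (1 - \<alpha>) * (t $ i * \<phi> (y $ i / t $ i))"
    if "x $ i \<noteq> y $ i" for i
  proof -
    have "\<phi> (z $ i / t $ i) < \<alpha> * \<phi> (x $ i / t $ i) + (1 - \<alpha>) * \<phi> (y $ i / t $ i)"
    proof -
      have "x $ i / t $ i \<in> {0..}" "y $ i / t $ i \<in> {0..}" "x $ i / t $ i \<noteq> y $ i / t $ i"
        using x y t[of i] that by (auto simp: divide_nonneg_pos)
      then show ?thesis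
        unfolding z using \<phi> \<alpha> unfolding strictly_convex_on_def by blast
    qed
    then have "t $ i * \<phi> (z $ i / t $ i)
        < t $ i * (\<alpha> * \<phi> (x $ i / t $ i) + (1 - \<alpha>) * \<phi> (y $ i / t $ i))"
      using t[of i] by simp
    then show ?thesis by (simp add: algebra_simps)
  qed
  have "real_phi_div \<phi> z t
      < (\<Sum>i\<in>UNIV. \<alpha> * (t $ i * \<phi> (x $ i / t $ i)) + (1 - \<alpha>) * (t $ i * \<phi> (y $ i / t $ i)))"
    unfolding real_phi_div_def
  proof (rule sum_strict_mono_ex1)
    show "\<forall>i\<in>UNIV. t $ i * \<phi> (z $ i / t $ i)
        \<le> \<alpha> * (t $ i * \<phi> (x $ i / t $ i)) + (1 - \<alpha>) * (t $ i * \<phi> (y $ i / t $ i))"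
    proof
      fix i show "t $ i * \<phi> (z $ i / t $ i)
        \<le> \<alpha> * (t $ i * \<phi> (x $ i / t $ i)) + (1 - \<alpha>) * (t $ i * \<phi> (y $ i / t $ i))"
      proof (cases "x $ i = y $ i")
        case True
        then have "z $ i = x $ i" by (simp add: z_def algebra_simps)
        with True show ?thesis by (simp add: algebra_simps)
      qed (use less in \<open>simp add: less_imp_le\<close>)
    qed
    show "\<exists>i\<in>UNIV. t $ i * \<phi> (z $ i / t $ i)
        < \<alpha> * (t $ i * \<phi> (x $ i / t $ i)) + (1 - \<alpha>) * (t $ i * \<phi> (y $ i / t $ i))"
      using \<open>x \<noteq> y\<close> less by (auto simp: vec_eq_iff)
  qed simp
  also have "\<dots> = \<alpha> * real_phi_div \<phi> x t + (1 - \<alpha>) * real_phi_div \<phi> y t"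
    by (simp add: real_phi_div_def sum.distrib sum_distrib_left)
  finally show "real_phi_div \<phi> (\<alpha> *\<^sub>R x + (1 - \<alpha>) *\<^sub>R y) t
      < \<alpha> * real_phi_div \<phi> x t + (1 - \<alpha>) * real_phi_div \<phi> y t"
    by (simp add: z_def)
qed

text \<open>Meant for f = \<open>deriv \<phi>\<close>: it supplies the joint derivative, in \<theta>
  and \<open>t\<close>, of each summand of the stationarity equation.\<close>

lemma scaled_argument_has_derivative:
  fixes a :: "'a::real_inner"
  assumes f: "(f has_field_derivative f') (at ((a \<bullet> \<theta> + c) / t $ i))" and t: "t $ i > 0"
  shows "((\<lambda>(\<theta>, t :: real^'m). f ((a \<bullet> \<theta> + c) / t $ i)) has_derivative
    (\<lambda>(h, k). f' * (a \<bullet> h / t $ i - (a \<bullet> \<theta> + c) / (t $ i)\<^sup>2 * k $ i))) (at (\<theta>, t))"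
proof -
  have "((\<lambda>z :: 'a \<times> (real^'m). (a \<bullet> fst z + c) / snd z $ i) has_derivative
    (\<lambda>z. a \<bullet> fst z / t $ i - (a \<bullet> \<theta> + c) / (t $ i)\<^sup>2 * snd z $ i)) (at (\<theta>, t))"
    using t by (auto intro!: derivative_eq_intros bounded_linear.has_derivative[OF bounded_linear_vec_nth]
        simp: field_simps power2_eq_square)
  from has_derivative_compose[OF this, of f "(*) f'"] f
  show ?thesis by (simp add: has_field_derivative_def case_prod_unfold)
qed

theorem corollary29:
  fixes \<phi> :: "real \<Rightarrow> real"
    and \<Theta> :: "(real^'k) set"
    and S :: "real^'k \<Rightarrow> real^'m"
    and M :: "(real^'m) set"
    and t0 :: "real^'m"
    and A :: "real^'k^'m"
    and \<gamma> :: "real^'m"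
  assumes phi_convex: "convex_on {0..} \<phi>"
    and phi_cont0: "continuous (at 0 within {0..}) \<phi>"
    and phi_strict: "strictly_convex_on {0<..} \<phi>"
    and phi_C2: "real_C2_on {0<..} \<phi>"
    and k_le_m: "CARD('k) \<le> CARD('m)"
    and Theta_bounded: "bounded \<Theta>"
    and Theta_interior: "interior \<Theta> \<noteq> {}"
    and S_range: "S ` closure \<Theta> \<subseteq> cbox 0 1"
    and S_cont: "continuous_on (closure \<Theta>) S"
    and S_inj: "inj_on S (closure \<Theta>)"
    and S_C2: "C2_on (interior \<Theta>) S"
    and S_interior: "S ` interior \<Theta> \<subseteq> box 0 1"
    and M_eq: "M = S ` closure \<Theta>"
    and t0: "t0 \<in> box 0 1"
    and M_convex: "convex M"
    and a: "\<forall>w>0. strongly_convex_on {0..1 / w} \<phi>"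
    and b: "S ` interior \<Theta> = M \<inter> box 0 1"
    and c: "\<forall>t\<in>box 0 1. \<forall>s. is_phi_projection \<phi> M t s \<longrightarrow> s \<in> box 0 1"
    and d_convex: "convex (closure \<Theta>)"
    and d_affine: "\<forall>\<theta>\<in>closure \<Theta>. S \<theta> = A *v \<theta> + \<gamma>"
  shows
    "(\<exists>U. open U \<and> t0 \<in> U \<and> U \<subseteq> box 0 1 \<and>
        (\<forall>t\<in>U.
           (\<exists>!s. is_phi_projection \<phi> M t s) \<and>
           (\<exists>!\<theta>. is_arg_inf (\<lambda>\<theta>. phi_div \<phi> (S \<theta>) t) (interior \<Theta>) \<theta>) \<and>
           (\<exists>!\<theta>. \<theta> \<in> interior \<Theta> \<and> S \<theta> = S_star \<phi> M t) \<and>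
           S (theta_star \<phi> \<Theta> S t) = S_star \<phi> M t))
     \<and> continuously_differentiable_at (theta_star \<phi> \<Theta> S) t0
     \<and> (let s0 = S (theta_star \<phi> \<Theta> S t0);
            B = transpose A **
                diag_matrix (\<chi> i. 1 / t0 $ i * deriv (deriv \<phi>) (s0 $ i / t0 $ i)) ** A;
            \<Delta> = diag_matrix (\<chi> i. s0 $ i / (t0 $ i)\<^sup>2 * deriv (deriv \<phi>) (s0 $ i / t0 $ i))
        in invertible B \<and>
           jacobian (theta_star \<phi> \<Theta> S) (at t0) = matrix_inv B ** transpose A ** \<Delta>)
     \<and> continuously_differentiable_at (S_star \<phi> M) t0
     \<and> jacobian (S_star \<phi> M) (at t0) = A ** jacobian (theta_star \<phi> \<Theta> S) (at t0)"
proof -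
  let ?P = "box 0 1 :: (real^'m) set" and ?I = "interior \<Theta>"
  define s where "s = S_star \<phi> M"
  define \<theta> where "\<theta> = theta_star \<phi> \<Theta> S"
  have P: "0 < t $ i" if "t \<in> ?P" for t i
    using that by (simp add: mem_box_cart)
  have I_sub: "?I \<subseteq> closure \<Theta>"
    using interior_subset closure_subset by blast
  have S_affine: "S x $ i = A $ i \<bullet> x + \<gamma> $ i" if "x \<in> ?I" for x i
    using that d_affine I_sub by (simp add: subsetD matrix_vector_mul_component)
  have M_nonneg: "M \<subseteq> {s. \<forall>i. 0 \<le> s $ i}"
    using S_range M_eq by (auto simp: mem_box_cart)

  \<comment> \<open>Regularity and convexity of \<phi>\<close>
  have \<phi>_cont: "continuous_on {0..} \<phi>"
  proof -
    have "continuous (at x within {0..}) \<phi>" if "x > 0" for x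
    proof -
      have "\<phi> differentiable at x" using phi_C2 that by (simp add: real_C2_on_def)
      then show ?thesis
        using continuous_at_imp_continuous_at_within differentiable_imp_continuous_within by blast
    qed
    with phi_cont0 show ?thesis
      by (force simp: continuous_on_eq_continuous_within less_le)
  qed
  have \<phi>_strong: "strongly_convex_on {0..r} \<phi>" if "r > 0" for r
    using a[rule_format, of "1 / r"] that by simp
  have \<phi>_strict: "strictly_convex_on {0..} \<phi>"
    unfolding strictly_convex_on_def
  proof (intro conjI ballI allI impI)
    fix x y \<alpha> :: real
    assume "x \<in> {0..}" "y \<in> {0..}" "x \<noteq> y" "0 < \<alpha>" "\<alpha> < 1"
    \<comment> \<open>Strong convexity is available on bounded intervals starting at 0, and this one
      contains both points. In this way strict convexity reaches the endpoint 0.\<close>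
    moreover have "strictly_convex_on {0..max x y} \<phi>"
      using \<phi>_strong calculation by (intro strongly_convex_on_imp_strictly_convex_on) auto
    ultimately show "\<phi> (\<alpha> *\<^sub>R x + (1 - \<alpha>) *\<^sub>R y) < \<alpha> * \<phi> x + (1 - \<alpha>) * \<phi> y"
      by (simp add: strictly_convex_on_def)
  qed simp
  have \<phi>': "(\<phi> has_field_derivative deriv \<phi> x) (at x)" if "x > 0" for x
    using phi_C2 that by (simp add: real_C2_on_def DERIV_deriv_iff_real_differentiable)
  have \<phi>'': "(deriv \<phi> has_field_derivative deriv (deriv \<phi>) x) (at x)" if "x > 0" for x
    using phi_C2 that by (simp add: real_C2_on_def DERIV_deriv_iff_real_differentiable)
  have \<phi>''_pos: "deriv (deriv \<phi>) x > 0" if "x > 0" for x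
  proof (rule strongly_convex_on_deriv2_pos)
    show "strongly_convex_on {0..x + 1} \<phi>" using \<phi>_strong that by simp
    show "{0<..<x + 1} \<subseteq> {0..x + 1}" by auto
  qed (use that \<phi>' \<phi>'' in auto)
  have \<phi>''_cont: "isCont (deriv (deriv \<phi>)) x" if "x > 0" for x
    using phi_C2 that by (auto simp: real_C2_on_def continuous_on_eq_continuous_at)

  \<comment> \<open>Existence, uniqueness and continuity of the projection\<close>
  have compact_closure: "compact (closure \<Theta>)"
    using Theta_bounded by simp
  have compact_M: "compact M"
    unfolding M_eq using S_cont compact_closure by (rule compact_continuous_image)
  have "M \<noteq> {}" using Theta_interior I_sub M_eq by auto
  have proj_iff: "is_phi_projection \<phi> M t x \<longleftrightarrow>
      x \<in> M \<and> (\<forall>y\<in>M. real_phi_div \<phi> x t \<le> real_phi_div \<phi> y t)" if "t \<in> ?P" for t x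
    using P[OF that] by (simp add: is_phi_projection_def is_arg_inf_iff phi_div_eq_real_phi_div)
  have cont_div: "continuous_on (M \<times> ?P) (\<lambda>z. real_phi_div \<phi> (fst z) (snd z))"
    using continuous_on_real_phi_div[OF \<phi>_cont] M_nonneg P
    by (rule_tac continuous_on_subset) auto
  have proj_unique: "y = x"
    if "t \<in> ?P" "is_phi_projection \<phi> M t x" "y \<in> M" "real_phi_div \<phi> y t \<le> real_phi_div \<phi> x t" for t x y
    using that P[OF that(1)]
    by (intro strictly_convex_on_minimizer_unique[OF strictly_convex_on_real_phi_div[OF \<phi>_strict] M_nonneg M_convex])
       (auto simp: proj_iff)
  have ex1_proj: "\<exists>!x. is_phi_projection \<phi> M t x" if t: "t \<in> ?P" for t
  proof -
    have "continuous_on M (\<lambda>x. real_phi_div \<phi> x t)"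
      using continuous_on_compose2[OF cont_div, of M "\<lambda>x. (x, t)"] t
        continuous_on_Pair[OF continuous_on_id continuous_on_const] by auto
    then obtain x where "x \<in> M" "\<forall>y\<in>M. real_phi_div \<phi> x t \<le> real_phi_div \<phi> y t"
      using continuous_attains_inf[OF compact_M \<open>M \<noteq> {}\<close>] by blast
    then have "is_phi_projection \<phi> M t x" by (simp add: proj_iff[OF t])
    then show ?thesis using proj_unique[OF t] t by (auto simp: proj_iff)
  qed
  have s_eq: "s t = (THE x. is_phi_projection \<phi> M t x)" for t
    by (simp add: s_def S_star_def arg_inf_def is_phi_projection_def)
  have s_proj: "is_phi_projection \<phi> M t (s t)" if "t \<in> ?P" for t
    unfolding s_eq using ex1_proj[OF that] by (rule theI')
  \<comment> \<open>Assumption \<open>c\<close> places the projection in the open cube, and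
    \<open>b\<close> identifies that part of \<open>M\<close> with the image of the
    interior.\<close>
  have s_mem: "s t \<in> S ` ?I" if "t \<in> ?P" for t
    using s_proj[OF that] c that proj_iff[OF that] b by blast
  have s_cont: "continuous_on ?P s"
  proof (rule continuous_on_unique_minimizer[OF compact_M cont_div])
    show "x = s t" if "t \<in> ?P" "x \<in> M"
        "real_phi_div \<phi> (fst (x, t)) (snd (x, t)) \<le> real_phi_div \<phi> (fst (s t, t)) (snd (s t, t))" for x t
      using proj_unique[OF that(1) s_proj[OF that(1)]] that by simp
  qed (use s_proj proj_iff in auto)

  \<comment> \<open>The parameter of the projection\<close>
  have argmin_iff: "is_arg_inf (\<lambda>x. phi_div \<phi> (S x) t) ?I x \<longleftrightarrow> x \<in> ?I \<and> S x = s t"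
    if t: "t \<in> ?P" for t x
  proof
    assume "is_arg_inf (\<lambda>x. phi_div \<phi> (S x) t) ?I x"
    then have x: "x \<in> ?I" "\<forall>y\<in>?I. real_phi_div \<phi> (S x) t \<le> real_phi_div \<phi> (S y) t"
      using P[OF t] by (simp_all add: is_arg_inf_iff phi_div_eq_real_phi_div)
    \<comment> \<open>The minimum over \<open>M\<close> is attained at a point of the image of the
      interior, so restricting to that image does not raise the infimum.\<close>
    then have "real_phi_div \<phi> (S x) t \<le> real_phi_div \<phi> (s t) t"
      using s_mem[OF t] by auto
    moreover have "S x \<in> M" using x(1) I_sub M_eq by auto
    ultimately show "x \<in> ?I \<and> S x = s t"
      using proj_unique[OF t s_proj[OF t]] x(1) by simp
  next
    assume x: "x \<in> ?I \<and> S x = s t"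
    have "S y \<in> M" if "y \<in> ?I" for y using that I_sub M_eq by auto
    then show "is_arg_inf (\<lambda>x. phi_div \<phi> (S x) t) ?I x"
      using x s_proj[OF t] P[OF t] by (simp add: is_arg_inf_iff phi_div_eq_real_phi_div proj_iff[OF t])
  qed
  have S_inj_I: "x = y" if "x \<in> ?I" "y \<in> ?I" "S x = S y" for x y
    using S_inj I_sub that by (meson inj_onD subsetD)
  have \<theta>: "\<theta> t \<in> ?I" "S (\<theta> t) = s t" if t: "t \<in> ?P" for t
  proof -
    obtain x where x: "x \<in> ?I" "S x = s t" using s_mem[OF t] by auto
    then have "\<theta> t = x"
      unfolding \<theta>_def theta_star_def
      by (intro arg_inf_eqI) (auto simp: argmin_iff[OF t] intro: S_inj_I)
    with x show "\<theta> t \<in> ?I" "S (\<theta> t) = s t" by simp_all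
  qed
  have ex1_\<theta>: "\<exists>!x. x \<in> ?I \<and> S x = s t" if "t \<in> ?P" for t
    using \<theta>[OF that] by (intro ex1I[of _ "\<theta> t"]) (auto intro: S_inj_I)
  have \<theta>_cont: "isCont \<theta> t" if t: "t \<in> ?P" for t
  proof -
    \<comment> \<open>A continuous injection on a compact set has a continuous inverse; hence the
      inverse is taken on the closure of \<Theta> and not on its interior.\<close>
    define g where "g = the_inv_into (closure \<Theta>) S"
    have "continuous_on (S ` closure \<Theta>) g"
      unfolding g_def using S_cont compact_closure S_inj by (rule continuous_on_inv_into)
    moreover have "s ` ?P \<subseteq> S ` closure \<Theta>"
      using s_mem image_mono[OF I_sub] by (meson image_subsetI subsetD)
    ultimately have "continuous_on ?P (\<lambda>t. g (s t))"
      by (rule continuous_on_compose2[OF _ s_cont])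
    moreover have "g (s t) = \<theta> t" if "t \<in> ?P" for t
      unfolding g_def using \<theta>[OF that] S_inj I_sub by (metis the_inv_into_f_f subsetD)
    ultimately have "continuous_on ?P \<theta>"
      by (simp cong: continuous_on_cong)
    with t show ?thesis by (simp add: continuous_on_eq_continuous_at[OF open_box])
  qed
  have quot_pos: "0 < S x $ i / t $ i" if "x \<in> ?I" "t \<in> ?P" for x t i
    using S_interior that P[of "S x"] P[of t] by (simp add: image_subset_iff)

  \<comment> \<open>The stationarity equation\<close>
  define G where "G = (\<lambda>(x, t). \<Sum>i\<in>UNIV. deriv \<phi> ((A $ i \<bullet> x + \<gamma> $ i) / t $ i) *\<^sub>R A $ i)"
  have G_zero: "G (\<theta> t, t) = 0" if t: "t \<in> ?P" for t
  proof -
    \<comment> \<open>The gradient of \<open>?F\<close> at \<open>\<theta> t\<close> is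
      \<open>G (\<theta> t, t)\<close>: the weight t_i cancels the factor 1/t_i from the chain rule.
      It vanishes because \<open>\<theta> t\<close> minimizes \<open>?F\<close> over an open
      set.\<close>
    let ?F = "\<lambda>x. \<Sum>i\<in>UNIV. t $ i * \<phi> ((A $ i \<bullet> x + \<gamma> $ i) / t $ i)"
    have "(?F has_derivative (\<lambda>h. G (\<theta> t, t) \<bullet> h)) (at (\<theta> t))"
    proof -
      have "((\<lambda>x. \<phi> ((A $ i \<bullet> x + \<gamma> $ i) / t $ i)) has_derivative
          (\<lambda>h. deriv \<phi> ((A $ i \<bullet> \<theta> t + \<gamma> $ i) / t $ i) * (A $ i \<bullet> h / t $ i))) (at (\<theta> t))" for i
      proof -
        have "((\<lambda>x. (A $ i \<bullet> x + \<gamma> $ i) / t $ i) has_derivative (\<lambda>h. A $ i \<bullet> h / t $ i)) (at (\<theta> t))"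
          using P[OF t, of i] by (auto intro!: derivative_eq_intros)
        from has_derivative_compose[OF this, of \<phi> "(*) (deriv \<phi> ((A $ i \<bullet> \<theta> t + \<gamma> $ i) / t $ i))"]
        show ?thesis
          using \<phi>'[OF quot_pos[OF \<theta>(1)[OF t] t, of i]] S_affine[OF \<theta>(1)[OF t]]
          by (simp add: has_field_derivative_def)
      qed
      then have "(?F has_derivative (\<lambda>h. \<Sum>i\<in>UNIV. t $ i *
          (deriv \<phi> ((A $ i \<bullet> \<theta> t + \<gamma> $ i) / t $ i) * (A $ i \<bullet> h / t $ i)))) (at (\<theta> t))"
        by (intro has_derivative_sum has_derivative_mult_right)
      also have "(\<lambda>h. \<Sum>i\<in>UNIV. t $ i *
          (deriv \<phi> ((A $ i \<bullet> \<theta> t + \<gamma> $ i) / t $ i) * (A $ i \<bullet> h / t $ i))) = (\<lambda>h. G (\<theta> t, t) \<bullet> h)"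
        using P[OF t, THEN less_imp_neq]
        by (auto simp: G_def inner_sum_left fun_eq_iff intro!: sum.cong)
      finally show ?thesis .
    qed
    moreover have "\<forall>y\<in>?I. ?F (\<theta> t) \<le> ?F y"
    proof
      fix y assume "y \<in> ?I"
      then have "real_phi_div \<phi> (S (\<theta> t)) t \<le> real_phi_div \<phi> (S y) t"
        using s_proj[OF t, unfolded proj_iff[OF t]] \<theta>(2)[OF t] I_sub M_eq by auto
      then show "?F (\<theta> t) \<le> ?F y"
        using S_affine \<open>y \<in> ?I\<close> \<theta>(1)[OF t] by (simp add: real_phi_div_def)
    qed
    ultimately have "(\<lambda>h. G (\<theta> t, t) \<bullet> h) = (\<lambda>h. 0)"
      using \<theta>(1)[OF t] by (intro differential_zero_maxmin[of "\<theta> t" ?I ?F]) auto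
    then show ?thesis by (metis inner_eq_zero_iff)
  qed

  \<comment> \<open>Injectivity of the linear part\<close>
  have inj_A: "inj ((*v) A)"
  proof -
    have "h = 0" if h: "A *v h = 0" for h
    proof -
      obtain x where x: "x \<in> ?I" using Theta_interior by auto
      then obtain e where e: "e > 0" "ball x e \<subseteq> ?I"
        using open_contains_ball_eq open_interior by blast
      \<comment> \<open>A shift along the kernel vector \<open>h\<close> leaves \<open>S\<close>
        unchanged as long as it stays in the interior. The scaling keeps its length below
        \<open>e\<close>, and the added 1 keeps the denominator positive when \<open>h\<close> is
        0.\<close>
      define y where "y = x + (e / (2 * (norm h + 1))) *\<^sub>R h"
      have "e * (norm h / (2 * (norm h + 1))) < e * 1"
        using e(1) by (intro mult_strict_left_mono) (auto simp: divide_less_eq add_nonneg_pos)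
      then have "y \<in> ?I"
        using e by (intro subsetD[OF e(2)]) (simp add: y_def dist_norm)
      moreover have "S y = S x"
        using d_affine I_sub x \<open>y \<in> ?I\<close>
        by (simp add: subsetD y_def matrix_vector_right_distrib matrix_vector_mult_scaleR h)
      ultimately have "y = x" using S_inj_I x by blast
      then show "h = 0" using e(1) by (auto simp: y_def add_nonneg_eq_0_iff)
    qed
    then show ?thesis by (simp add: vec.inj_iff_eq_0)
  qed

  \<comment> \<open>Derivatives of the parameter and of the projection\<close>
  define v where "v t = (\<chi> i. 1 / t $ i * deriv (deriv \<phi>) (s t $ i / t $ i))" for t
  define w where "w t = (\<chi> i. s t $ i / (t $ i)\<^sup>2 * deriv (deriv \<phi>) (s t $ i / t $ i))" for t
  \<comment> \<open>At \<open>(\<theta> t, t)\<close>, \<open>B t\<close> is the derivative of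
    \<open>G\<close> in its first variable, while \<open>transpose A ** diag_matrix (w t)\<close> is
    minus its derivative in the second.\<close>
  define B where "B t = transpose A ** diag_matrix (v t) ** A" for t
  define J where "J t = matrix_inv (B t) ** transpose A ** diag_matrix (w t)" for t
  have s_quot_pos: "0 < s t $ i / t $ i" if "t \<in> ?P" for t i
    using quot_pos[OF \<theta>(1)[OF that] that] \<theta>(2)[OF that] by simp
  have inv_B: "invertible (B t)" if t: "t \<in> ?P" for t
    unfolding B_def using P[OF t] \<phi>''_pos[OF s_quot_pos[OF t]]
    by (intro invertible_transpose_diag_mult inj_A) (simp add: v_def)
  have \<theta>_deriv: "(\<theta> has_derivative (*v) (J t)) (at t)" if t: "t \<in> ?P" for t
  proof -
    have s_affine: "A $ i \<bullet> \<theta> t + \<gamma> $ i = s t $ i" for i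
      using S_affine[OF \<theta>(1)[OF t], of i] \<theta>(2)[OF t] by simp
    have "((\<lambda>(x, t). deriv \<phi> ((A $ i \<bullet> x + \<gamma> $ i) / t $ i)) has_derivative
        (\<lambda>(h, k). deriv (deriv \<phi>) (s t $ i / t $ i) *
           (A $ i \<bullet> h / t $ i - s t $ i / (t $ i)\<^sup>2 * k $ i))) (at (\<theta> t, t))" for i
      using scaled_argument_has_derivative[of "deriv \<phi>" _ "A $ i" "\<theta> t" "\<gamma> $ i" t i]
        \<phi>''[OF s_quot_pos[OF t, of i]] P[OF t, of i] by (simp add: s_affine)
    then have "(G has_derivative (\<lambda>z. \<Sum>i\<in>UNIV. (case z of (h, k) \<Rightarrow> deriv (deriv \<phi>) (s t $ i / t $ i) *
           (A $ i \<bullet> h / t $ i - s t $ i / (t $ i)\<^sup>2 * k $ i)) *\<^sub>R A $ i)) (at (\<theta> t, t))"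
      unfolding G_def case_prod_unfold by (intro has_derivative_sum has_derivative_scaleR_left)
    also have "(\<lambda>z. \<Sum>i\<in>UNIV. (case z of (h, k) \<Rightarrow> deriv (deriv \<phi>) (s t $ i / t $ i) *
           (A $ i \<bullet> h / t $ i - s t $ i / (t $ i)\<^sup>2 * k $ i)) *\<^sub>R A $ i)
        = (\<lambda>(h, k). B t *v h + - ((transpose A ** diag_matrix (w t)) *v k))"
    proof -
      have "B t *v h = (\<Sum>i\<in>UNIV. (v t $ i * (A $ i \<bullet> h)) *\<^sub>R A $ i)" for h
        unfolding B_def matrix_vector_mul_assoc[symmetric, of _ A] transpose_diag_matrix_mult_vector
        by (simp add: matrix_vector_mul_component)
      then show ?thesis
        unfolding transpose_diag_matrix_mult_vector
        by (auto simp: fun_eq_iff v_def w_def algebra_simps simp flip: sum_subtractf intro!: sum.cong)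
    qed
    finally have "(G has_derivative
        (\<lambda>(h, k). B t *v h + - ((transpose A ** diag_matrix (w t)) *v k))) (at (\<theta> t, t))" .
    moreover have "\<forall>\<^sub>F y in nhds t. G (\<theta> y, y) = 0"
      using G_zero t by (auto simp: eventually_nhds intro!: exI[of _ ?P])
    \<comment> \<open>The minus sign of implicit differentiation cancels that of the second partial
      derivative, so \<open>J t\<close> carries no sign.\<close>
    ultimately have "(\<theta> has_derivative
        (\<lambda>k. - (matrix_inv (B t) *v - ((transpose A ** diag_matrix (w t)) *v k)))) (at t)"
      by (intro has_derivative_implicit[OF \<theta>_cont[OF t]])
         (auto simp: matrix_vector_mul_assoc matrix_inv_left_right inv_B[OF t])
    also have "(\<lambda>k. - (matrix_inv (B t) *v - ((transpose A ** diag_matrix (w t)) *v k))) = (*v) (J t)"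
      by (simp add: J_def fun_eq_iff matrix_vector_mul_assoc matrix_mul_assoc vec.neg)
    finally show ?thesis .
  qed
  have jacobian_eq: "jacobian f (at x) = X" if "(f has_derivative (*v) X) (at x)"
    for f :: "real^'m \<Rightarrow> real^'n" and x X
    using frechet_derivative_at[OF that] by (simp add: jacobian_def matrix_of_matrix_vector_mul flip: frechet_derivative_at[OF that])
  have nhds_P: "\<forall>\<^sub>F t in nhds t0. t \<in> ?P"
    using t0 by (intro eventually_nhds_in_open) auto
  have J_cont: "isCont J t0"
  proof -
    \<comment> \<open>The formula for \<open>J\<close> depends on \<open>t\<close> through
      \<open>t\<close> itself and through \<open>s t\<close>; continuity of both, and of the second
      derivative of \<phi>, is all that enters.\<close>
    have "isCont s t0" using s_cont t0 by (simp add: continuous_on_eq_continuous_at[OF open_box])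
    have quot: "isCont (\<lambda>t. deriv (deriv \<phi>) (s t $ i / t $ i)) t0" for i
    proof (rule isCont_o2[where f = "\<lambda>t. s t $ i / t $ i"])
      show "isCont (\<lambda>t. s t $ i / t $ i) t0"
        using P[OF t0, of i] \<open>isCont s t0\<close> by (intro isCont_divide isCont_vec_nth continuous_ident) auto
    qed (rule \<phi>''_cont[OF s_quot_pos[OF t0]])
    have "isCont v t0" "isCont w t0"
      unfolding v_def[abs_def] w_def[abs_def] using P[OF t0, THEN less_imp_neq] \<open>isCont s t0\<close>
      by (auto intro!: isCont_vec_lambda isCont_mult quot isCont_divide isCont_vec_nth isCont_power)
    then show ?thesis
      unfolding J_def[abs_def] B_def[abs_def] using nhds_P inv_B
      by (intro isCont_matrix_matrix_mult isCont_matrix_inv isCont_diag_matrix continuous_const)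
         (auto elim!: eventually_mono simp: B_def)
  qed
  have s_deriv: "(s has_derivative (*v) (A ** J t)) (at t)" if t: "t \<in> ?P" for t
  proof -
    \<comment> \<open>This affine image of \<theta> is known to equal \<open>s\<close> on the open
      cube, which suffices because derivatives are local.\<close>
    have "((\<lambda>t. A *v \<theta> t + \<gamma>) has_derivative (\<lambda>h. A *v (J t *v h))) (at t)"
      using \<theta>_deriv[OF t]
      by (auto intro!: derivative_eq_intros bounded_linear.has_derivative[OF matrix_vector_mul_bounded_linear])
    then have "(s has_derivative (\<lambda>h. A *v (J t *v h))) (at t)"
    proof (rule has_derivative_transform_within_open[of _ _ _ _ ?P])
      show "A *v \<theta> u + \<gamma> = s u" if "u \<in> ?P" for u
        using \<theta>[OF that] d_affine I_sub by (metis subsetD)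
    qed (use t in auto)
    then show ?thesis by (simp add: matrix_vector_mul_assoc)
  qed
  have C1: "continuously_differentiable_at f t0"
    if "\<And>t. t \<in> ?P \<Longrightarrow> (f has_derivative (*v) (X t)) (at t)" "isCont X t0"
    for f :: "real^'m \<Rightarrow> real^'n" and X
    unfolding continuously_differentiable_at_def
  proof
    show "\<exists>U. open U \<and> t0 \<in> U \<and> (\<forall>y\<in>U. f differentiable at y)"
      using that(1) t0 by (intro exI[of _ ?P]) (auto simp: differentiable_def)
    have "\<forall>\<^sub>F t in nhds t0. jacobian f (at t) = X t"
      using nhds_P by eventually_elim (rule jacobian_eq[OF that(1)])
    then show "isCont (\<lambda>t. jacobian f (at t)) t0"
      using that(2) by (simp add: isCont_cong)
  qed

  \<comment> \<open>Well-definedness near \<open>t0\<close> and conclusion\<close>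
  have local: "\<exists>U. open U \<and> t0 \<in> U \<and> U \<subseteq> box 0 1 \<and>
        (\<forall>t\<in>U.
           (\<exists>!s. is_phi_projection \<phi> M t s) \<and>
           (\<exists>!\<theta>. is_arg_inf (\<lambda>\<theta>. phi_div \<phi> (S \<theta>) t) (interior \<Theta>) \<theta>) \<and>
           (\<exists>!\<theta>. \<theta> \<in> interior \<Theta> \<and> S \<theta> = S_star \<phi> M t) \<and>
           S (theta_star \<phi> \<Theta> S t) = S_star \<phi> M t)"
    unfolding s_def[symmetric] \<theta>_def[symmetric]
  \<comment> \<open>The whole open cube serves as the neighborhood, since nothing so far used that
    \<open>t\<close> is close to \<open>t0\<close>, except for the continuity of the
    Jacobian.\<close>
  proof (intro exI[of _ ?P] conjI ballI)
    fix t assume t: "t \<in> ?P"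
    show "\<exists>!x. is_phi_projection \<phi> M t x" by (rule ex1_proj[OF t])
    show "\<exists>!x. x \<in> ?I \<and> S x = s t" by (rule ex1_\<theta>[OF t])
    then show "\<exists>!x. is_arg_inf (\<lambda>x. phi_div \<phi> (S x) t) ?I x"
      unfolding argmin_iff[OF t] .
    show "S (\<theta> t) = s t" by (rule \<theta>(2)[OF t])
  qed (rule open_box t0 subset_refl)+
  have C1_\<theta>: "continuously_differentiable_at \<theta> t0"
    by (rule C1[OF \<theta>_deriv J_cont])
  have "isCont (\<lambda>t. A ** J t) t0"
    by (rule isCont_matrix_matrix_mult[OF continuous_const J_cont])
  with s_deriv have C1_s: "continuously_differentiable_at s t0"
    by (rule C1)
  have J_\<theta>: "jacobian \<theta> (at t0) = J t0"
    by (rule jacobian_eq[OF \<theta>_deriv[OF t0]])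
  have J_s: "jacobian s (at t0) = A ** J t0"
    by (rule jacobian_eq[OF s_deriv[OF t0]])
  have J_\<theta>': "jacobian \<theta> (at t0) = matrix_inv (B t0) ** transpose A ** diag_matrix (w t0)"
    using J_\<theta> by (simp only: J_def)
  have J_s': "jacobian s (at t0) = A ** jacobian \<theta> (at t0)"
    by (simp only: J_s J_\<theta>)
  show ?thesis
    using local C1_\<theta> inv_B[OF t0] J_\<theta>' C1_s J_s'
    unfolding Let_def \<theta>_def[symmetric] s_def[symmetric] \<theta>(2)[OF t0] B_def v_def w_def
    by (intro conjI)
qed

end
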